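(* Let $I$ be a non-trivial admissible ideal on $\mathbb{N}$ satisfying the property (AP), let $D\subset\mathbb{R}$, let $f:D\to\mathbb{R}$, and let $x_0\in D$. If $f$ is rough $I$-continuous at $x_0$, then $f$ is rough $I^*$-continuous at $x_0$.
   Context: An ideal on $\mathbb{N}$ is a collection $I$ of subsets of $\mathbb{N}$ such that $A,B\in I$ implies $A\cup B\in I$, and $A\in I$, $B\subset A$ implies $B\in I$. It is non-trivial if $I\ne\emptyset$ and $\mathbb{N}\notin I$, and admissible if $\{n\}\in I$ for every $n\in\mathbb{N}$. The filter associated with $I$ is $F(I)=\{\mathbb{N}\setminus A: A\in I\}$. An admissible ideal $I$ satisfies the property (AP) if for every countable family of mutually disjoint sets $\{A_1,A_2,\ldots\}$ belonging to $I$ there is a countable family of sets $\{B_1,B_2,\ldots\}$ such that the symmetric difference $A_j\Delta B_j$ is finite for each $j\in\mathbb{N}$ and $\bigcup_{j=1}^\infty B_j\in I$. Let $\{y_n\}_{n\in\mathbb{N}}$ be a real sequence, $y\in\mathbb{R}$ and $r\ge 0$ a real number. The sequence is rough $I$-convergent of roughness degree $r$ to $y$ if $\{n\in\mathbb{N}:|y_n-y|\ge r+\varepsilon\}\in I$ for every $\varepsilon>0$. It is rough $I^*$-convergent of roughness degree $r$ to $y$ if there is a set $M=\{m_1<m_2<\cdots<m_k<\cdots\}\in F(I)$ such that for every $\varepsilon>0$ there is $N\in\mathbb{N}$ with $|y_{m_k}-y|<r+\varepsilon$ for all $k\ge N$. It is $I$-convergent (respectively $I^*$-convergent) to $y$ if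 it is rough $I$-convergent (respectively rough $I^*$-convergent) of roughness degree $0$ to $y$. A function $f:D\to\mathbb{R}$ is rough $I$-continuous at $x\in D$ if there is a real number $r\ge 0$ such that for every sequence $\{x_n\}\subset D$ that is $I$-convergent to $x$, $\{f(x_n)\}$ is rough $I$-convergent of roughness degree $r$ to $f(x)$. It is rough $I^*$-continuous at $x\in D$ if there is a real number $r\ge 0$ such that for every sequence $\{x_n\}\subset D$ that is $I^*$-convergent to $x$, $\{f(x_n)\}$ is rough $I^*$-convergent of roughness degree $r$ to $f(x)$. *)

theory Defs
  imports Complex_Main "HOL-Library.Disjoint_Sets"
begin

(* Index sets: \<nat> is the type nat, which starts at 0 where the source may start at 1;
   all notions below are invariant under this relabelling. *)

definition set_ideal :: "nat set set \<Rightarrow> bool" where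
  "set_ideal I \<longleftrightarrow>
     (\<forall>A B. A \<in> I \<and> B \<in> I \<longrightarrow> A \<union> B \<in> I) \<and> (\<forall>A B. A \<in> I \<and> B \<subseteq> A \<longrightarrow> B \<in> I)"

definition nontrivial_ideal :: "nat set set \<Rightarrow> bool" where
  "nontrivial_ideal I \<longleftrightarrow> set_ideal I \<and> I \<noteq> {} \<and> UNIV \<notin> I"

definition admissible_ideal :: "nat set set \<Rightarrow> bool" where
  "admissible_ideal I \<longleftrightarrow> set_ideal I \<and> (\<forall>n. {n} \<in> I)"

definition ideal_filter :: "nat set set \<Rightarrow> nat set set" where
  "ideal_filter I = {UNIV - A | A. A \<in> I}"

(* disjoint_family lets the empty set occur at several indices,
   so finite families are covered as well. *)
definition property_AP :: "nat set set \<Rightarrow> bool" where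
  "property_AP I \<longleftrightarrow>
     (\<forall>A :: nat \<Rightarrow> nat set. disjoint_family A \<and> (\<forall>j. A j \<in> I) \<longrightarrow>
        (\<exists>B :: nat \<Rightarrow> nat set.
           (\<forall>j. finite ((A j - B j) \<union> (B j - A j))) \<and> (\<Union>j. B j) \<in> I))"

(* The roughness degree r is meant to be nonnegative; the users of the next two
   definitions impose this. *)
definition rough_I_convergent :: "nat set set \<Rightarrow> real \<Rightarrow> (nat \<Rightarrow> real) \<Rightarrow> real \<Rightarrow> bool" where
  "rough_I_convergent I r y l \<longleftrightarrow> (\<forall>\<epsilon>>0. {n. \<bar>y n - l\<bar> \<ge> r + \<epsilon>} \<in> I)"

(* m is the increasing enumeration of M; in particular M is infinite. *)
definition rough_Istar_convergent :: "nat set set \<Rightarrow> real \<Rightarrow> (nat \<Rightarrow> real) \<Rightarrow> real \<Rightarrow> bool" where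
  "rough_Istar_convergent I r y l \<longleftrightarrow>
     (\<exists>M \<in> ideal_filter I. \<exists>m :: nat \<Rightarrow> nat. strict_mono m \<and> range m = M \<and>
        (\<forall>\<epsilon>>0. \<exists>N. \<forall>k\<ge>N. \<bar>y (m k) - l\<bar> < r + \<epsilon>))"

definition I_convergent :: "nat set set \<Rightarrow> (nat \<Rightarrow> real) \<Rightarrow> real \<Rightarrow> bool" where
  "I_convergent I y l \<longleftrightarrow> rough_I_convergent I 0 y l"

definition Istar_convergent :: "nat set set \<Rightarrow> (nat \<Rightarrow> real) \<Rightarrow> real \<Rightarrow> bool" where
  "Istar_convergent I y l \<longleftrightarrow> rough_Istar_convergent I 0 y l"

(* A function D \<rightarrow> \<real> is a total function of which only the values on D matter. *)
definition rough_I_continuous_at ::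
  "nat set set \<Rightarrow> real set \<Rightarrow> (real \<Rightarrow> real) \<Rightarrow> real \<Rightarrow> bool" where
  "rough_I_continuous_at I D f x \<longleftrightarrow>
     (\<exists>r\<ge>0. \<forall>s :: nat \<Rightarrow> real. (\<forall>n. s n \<in> D) \<and> I_convergent I s x \<longrightarrow>
        rough_I_convergent I r (\<lambda>n. f (s n)) (f x))"

definition rough_Istar_continuous_at ::
  "nat set set \<Rightarrow> real set \<Rightarrow> (real \<Rightarrow> real) \<Rightarrow> real \<Rightarrow> bool" where
  "rough_Istar_continuous_at I D f x \<longleftrightarrow>
     (\<exists>r\<ge>0. \<forall>s :: nat \<Rightarrow> real. (\<forall>n. s n \<in> D) \<and> Istar_convergent I s x \<longrightarrow>
        rough_Istar_convergent I r (\<lambda>n. f (s n)) (f x))"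

end

theory Submission
  imports Defs "HOL-Library.Infinite_Set"
begin

text \<open>
  Rough \<open>I\<^sup>*\<close>-convergence always implies rough \<open>I\<close>-convergence. Conversely, apply (AP) to
  the disjointed sets of indices with \<open>\<bar>y n - l\<bar> \<ge> r + 1 / (j + 1)\<close>: outside the set
  \<open>\<Union>j. B j \<in> I\<close> only finitely many indices remain in each of them, so the complement of that
  set carries a subsequence witnessing rough \<open>I\<^sup>*\<close>-convergence. Hence the same roughness
  degree works for both kinds of continuity.
\<close>

lemma set_ideal_Un: "set_ideal I \<Longrightarrow> A \<in> I \<Longrightarrow> B \<in> I \<Longrightarrow> A \<union> B \<in> I"
  unfolding set_ideal_def by blast

lemma set_ideal_subset: "set_ideal I \<Longrightarrow> A \<in> I \<Longrightarrow> B \<subseteq> A \<Longrightarrow> B \<in> I"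
  unfolding set_ideal_def by blast

lemma admissible_ideal_finite:
  assumes "admissible_ideal I" and "finite A"
  shows "A \<in> I"
  using assms(2)
proof induction
  case empty
  show ?case
    using assms(1) set_ideal_subset[of I "{0}" "{}"] by (auto simp: admissible_ideal_def)
next
  case (insert x F)
  then show ?case
    using assms(1) set_ideal_Un[of I "{x}" F] by (auto simp: admissible_ideal_def)
qed

text \<open>An index where \<open>y\<close> is at least \<open>r + \<epsilon>\<close> away from
  \<open>l\<close> either lies outside the range of \<open>m\<close>, hence in a set of
  \<open>I\<close>, or is one of the finitely many \<open>m k\<close> with \<open>k < N\<close>;
  admissibility absorbs the latter.\<close>

lemma rough_Istar_convergent_imp_rough_I_convergent:
  assumes adm: "admissible_ideal I" and conv: "rough_Istar_convergent I r y l"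
  shows "rough_I_convergent I r y l"
  unfolding rough_I_convergent_def
proof (intro allI impI)
  fix \<epsilon> :: real
  assume "\<epsilon> > 0"
  have ideal: "set_ideal I"
    using adm by (simp add: admissible_ideal_def)
  obtain A and m :: "nat \<Rightarrow> nat" where "A \<in> I" and range: "range m = UNIV - A"
    and lim: "\<forall>\<epsilon>>0. \<exists>N. \<forall>k\<ge>N. \<bar>y (m k) - l\<bar> < r + \<epsilon>"
    using conv by (auto simp: rough_Istar_convergent_def ideal_filter_def)
  obtain N where N: "\<And>k. k \<ge> N \<Longrightarrow> \<bar>y (m k) - l\<bar> < r + \<epsilon>"
    using lim \<open>\<epsilon> > 0\<close> by meson
  have "A \<union> m ` {..<N} \<in> I"
    by (rule set_ideal_Un[OF ideal \<open>A \<in> I\<close> admissible_ideal_finite[OF adm]]) simp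
  moreover have "{n. \<bar>y n - l\<bar> \<ge> r + \<epsilon>} \<subseteq> A \<union> m ` {..<N}"
  proof
    fix n
    assume n: "n \<in> {n. \<bar>y n - l\<bar> \<ge> r + \<epsilon>}"
    show "n \<in> A \<union> m ` {..<N}"
    proof (cases "n \<in> A")
      case False
      then obtain k where "n = m k"
        using range by blast
      with n N[of k] show ?thesis
        by (cases "k < N") auto
    qed simp
  qed
  ultimately show "{n. \<bar>y n - l\<bar> \<ge> r + \<epsilon>} \<in> I"
    using ideal set_ideal_subset by blast
qed

lemma rough_I_convergent_imp_rough_Istar_convergent:
  assumes nontriv: "nontrivial_ideal I" and adm: "admissible_ideal I" and AP: "property_AP I"
    and conv: "rough_I_convergent I r y l"
  shows "rough_Istar_convergent I r y l"
proof -
  have ideal: "set_ideal I"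
    using adm by (simp add: admissible_ideal_def)
  define C where "C j = {n. \<bar>y n - l\<bar> \<ge> r + inverse (real (Suc j))}" for j
  \<comment> \<open>The sets \<open>C j\<close> overlap, while (AP) speaks of disjoint families, so
    it is applied to \<open>disjointed C\<close>.\<close>
  have "disjointed C j \<in> I" for j
  proof (rule set_ideal_subset[OF ideal])
    show "C j \<in> I"
      using conv by (simp add: C_def rough_I_convergent_def)
  qed (rule disjointed_subset)
  then obtain B where fin: "\<And>j. finite ((disjointed C j - B j) \<union> (B j - disjointed C j))"
    and B: "(\<Union>j. B j) \<in> I"
    using AP disjoint_family_disjointed[of C] unfolding property_AP_def by blast
  define M where "M = UNIV - (\<Union>j. B j)"
  \<comment> \<open>Needed for the increasing enumeration of \<open>M\<close>. Were \<open>M\<close>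
    finite, it would belong to \<open>I\<close>, and so would its union with all \<open>B j\<close>,
    which is \<open>UNIV\<close>.\<close>
  have "infinite M"
  proof
    assume "finite M"
    then have "M \<union> (\<Union>j. B j) \<in> I"
      using set_ideal_Un[OF ideal admissible_ideal_finite[OF adm] B] by blast
    then show False
      using nontriv by (simp add: M_def nontrivial_ideal_def)
  qed
  have fin_inter: "finite (C j \<inter> M)" for j
  proof (rule finite_subset)
    \<comment> \<open>A point of \<open>C j\<close> lies in \<open>disjointed C i\<close> for some
      \<open>i \<le> j\<close>, and a point of \<open>M\<close> lies in no \<open>B i\<close>. Each
      of these differences is finite by the choice of \<open>B\<close>.\<close>
    show "C j \<inter> M \<subseteq> (\<Union>i\<in>{..j}. disjointed C i - B i)"
    proof
      fix n
      assume n: "n \<in> C j \<inter> M"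
      then have "n \<in> (\<Union>i\<in>{0..<Suc j}. C i)"
        by auto
      then have "n \<in> (\<Union>i\<in>{0..<Suc j}. disjointed C i)"
        by (simp only: finite_UN_disjointed_eq)
      with n show "n \<in> (\<Union>i\<in>{..j}. disjointed C i - B i)"
        by (auto simp: M_def less_Suc_eq_le)
    qed
    show "finite (\<Union>i\<in>{..j}. disjointed C i - B i)"
      using fin by auto
  qed
  show ?thesis
    unfolding rough_Istar_convergent_def
  proof (intro bexI[of _ M] exI[of _ "enumerate M"] conjI allI impI)
    show "M \<in> ideal_filter I"
      using B by (auto simp: M_def ideal_filter_def)
    show "strict_mono (enumerate M)"
      using \<open>infinite M\<close> by (rule strict_mono_enumerate)
    show "range (enumerate M) = M"
      using \<open>infinite M\<close> by (rule range_enumerate)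
    fix \<epsilon> :: real
    assume "\<epsilon> > 0"
    then obtain j where j: "inverse (real (Suc j)) < \<epsilon>"
      using reals_Archimedean by blast
    \<comment> \<open>This bound on the elements of \<open>C j \<inter> M\<close> also serves as a
      bound on positions in the enumeration, because \<open>k \<le> enumerate M k\<close>.\<close>
    obtain N where N: "\<And>n. n \<in> C j \<inter> M \<Longrightarrow> n < N"
      using fin_inter[of j] unfolding finite_nat_set_iff_bounded by blast
    show "\<exists>N. \<forall>k\<ge>N. \<bar>y (enumerate M k) - l\<bar> < r + \<epsilon>"
    proof (intro exI allI impI)
      fix k
      assume "k \<ge> N"
      then have "enumerate M k \<ge> N"
        using le_enumerate[OF \<open>infinite M\<close>, of k] by simp
      then have "enumerate M k \<notin> C j"
        using N[of "enumerate M k"] enumerate_in_set[OF \<open>infinite M\<close>, of k] by auto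
      with j show "\<bar>y (enumerate M k) - l\<bar> < r + \<epsilon>"
        by (simp add: C_def)
    qed
  qed
qed

theorem theorem4p5:
  fixes I :: "nat set set" and D :: "real set" and f :: "real \<Rightarrow> real" and x0 :: real
  assumes "nontrivial_ideal I"
    and "admissible_ideal I"
    and "property_AP I"
    and "x0 \<in> D"
    and "rough_I_continuous_at I D f x0"
  shows "rough_Istar_continuous_at I D f x0"
proof -
  obtain r where "r \<ge> 0" and r: "\<And>s. \<forall>n. s n \<in> D \<Longrightarrow> I_convergent I s x0
      \<Longrightarrow> rough_I_convergent I r (\<lambda>n. f (s n)) (f x0)"
    using assms(5) unfolding rough_I_continuous_at_def by blast
  show ?thesis
    unfolding rough_Istar_continuous_at_def
  proof (intro exI conjI allI impI)
    show "r \<ge> 0" by fact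
    fix s :: "nat \<Rightarrow> real"
    assume s: "(\<forall>n. s n \<in> D) \<and> Istar_convergent I s x0"
    \<comment> \<open>The two implications are used in opposite directions: from \<open>I*\<close>
      to \<open>I\<close> for \<open>s\<close> at degree 0, then from \<open>I\<close> to
      \<open>I*\<close> for the image sequence at degree \<open>r\<close>.\<close>
    then have "I_convergent I s x0"
      using rough_Istar_convergent_imp_rough_I_convergent[OF assms(2)]
      by (simp add: I_convergent_def Istar_convergent_def)
    with s have "rough_I_convergent I r (\<lambda>n. f (s n)) (f x0)"
      by (intro r) auto
    then show "rough_Istar_convergent I r (\<lambda>n. f (s n)) (f x0)"
      by (rule rough_I_convergent_imp_rough_Istar_convergent[OF assms(1-3)])
  qed
qed

end
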